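(* Let $(x_n,f_n)_{n=1}^\infty$ be a Schauder frame (respectively, an unconditional Schauder frame) of a Banach space $X$. Let $\{y_n\}_{n=1}^\infty$ be a sequence in $X$ which satisfies $\mu:=\sum_{n=1}^\infty\|x_n-y_n\|\,\|f_n\|<1$. Then there exists a sequence $\{g_n\}_{n=1}^\infty$ in $X^*$ such that $(y_n,g_n)_{n=1}^\infty$ is a Schauder frame (respectively, an unconditional Schauder frame) of $X$, and such that the following also holds. If, in addition, $x_n\neq0$ for all $n$ and $\lambda:=\sum_{n=1}^\infty\frac{\|x_n-y_n\|}{\|x_n\|}<\infty$, then $Z_{Min}$ (the minimal space with respect to $(x_n,f_n)_{n=1}^\infty$, with its minimal basis $\{e_n^{Min}\}_{n=1}^\infty$) is a sequence space associated to $(y_n,g_n)_{n=1}^\infty$; namely, the operator $U:Z_{Min}\to X$, $U\left(\sum_{n=1}^\infty c_ne_n^{Min}\right)=\sum_{n=1}^\infty c_ny_n$, is well defined and bounded with $\|U\|\le1+\lambda$, and $V:X\to Z_{Min}$, $V(x)=\sum_{n=1}^\infty g_n(x)e_n^{Min}$, is also a (well-defined) bounded operator, which satisfies $$\frac{1}{1+\lambda}\|x\|\le\|V(x)\|\le\frac{K}{1-\mu}\|x\|\qquad\text{for all }x\in X,$$ where $K$ is the projection constant of $(x_n,f_n)_{n=1}^\infty$.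
   Context: Let $X$ be a separable Banach space. A sequence $(x_n,f_n)_{n=1}^\infty$ with $x_n\in X$, $f_n\in X^*$ is a Schauder frame of $X$ if $x=\sum_{n=1}^\infty f_n(x)x_n$ (norm convergence) for every $x\in X$; it is an unconditional Schauder frame if this series converges unconditionally for every $x\in X$. The projection constant of a Schauder frame $(x_n,f_n)_{n=1}^\infty$ is $K:=\sup_{x\in B_X}\sup_{m\le n}\left\|\sum_{i=m}^nf_i(x)x_i\right\|<\infty$, where $B_X$ is the unit ball of $X$. For a Schauder frame $(x_n,f_n)_{n=1}^\infty$ with all $x_n\ne0$, define on $c_{00}$ (finitely supported scalar sequences, with unit vectors $e_i$) the norm $\left\|\sum_ic_ie_i\right\|_{Min}=\max_{m\le n}\left\|\sum_{i=m}^nc_ix_i\right\|$. The minimal space $Z_{Min}$ with respect to $(x_n,f_n)_{n=1}^\infty$ is the completion of $(c_{00},\|\cdot\|_{Min})$. The unit vectors, denoted $\{e_n^{Min}\}_{n=1}^\infty$, form a (bi-monotone Schauder) basis of $Z_{Min}$, called the minimal basis. A Banach space $Z$ with a Schauder basis $\{z_n\}_{n=1}^\infty$ is a sequence space associated to a Schauder frame $(y_n,g_n)_{n=1}^\infty$ of $X$ if $Z\to X$, $\sum c_nz_n\mapsto\sum c_ny_n$, and $X\to Z$, $x\mapsto\sum g_n(x)z_n$, are (well-defined) bounded operators. *)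

theory Defs
  imports "HOL-Analysis.Analysis" "HOL-Analysis.Finite_Function_Topology"
begin

section \<open>Schauder frames\<close>

text \<open>Sequences are indexed by \<^typ>\<open>nat\<close>, so the first term has index 0.\<close>

definition schauder_frame ::
  "(nat \<Rightarrow> 'a::banach) \<Rightarrow> (nat \<Rightarrow> 'a \<Rightarrow>\<^sub>L real) \<Rightarrow> bool" where
  "schauder_frame x f \<longleftrightarrow> (\<forall>v. (\<lambda>n. f n v *\<^sub>R x n) sums v)"

definition unconditionally_convergent :: "(nat \<Rightarrow> 'a::real_normed_vector) \<Rightarrow> bool" where
  "unconditionally_convergent u \<longleftrightarrow> (\<forall>p. bij p \<longrightarrow> summable (\<lambda>n. u (p n)))"

definition unconditional_schauder_frame ::
  "(nat \<Rightarrow> 'a::banach) \<Rightarrow> (nat \<Rightarrow> 'a \<Rightarrow>\<^sub>L real) \<Rightarrow> bool" where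
  "unconditional_schauder_frame x f \<longleftrightarrow>
     schauder_frame x f \<and> (\<forall>v. unconditionally_convergent (\<lambda>n. f n v *\<^sub>R x n))"

text \<open>For a Schauder frame the supremum is finite by the uniform boundedness principle.\<close>

definition projection_constant ::
  "(nat \<Rightarrow> 'a::banach) \<Rightarrow> (nat \<Rightarrow> 'a \<Rightarrow>\<^sub>L real) \<Rightarrow> real" where
  "projection_constant x f =
     (SUP (v, m, n) \<in> {(v, m, n). norm v \<le> 1 \<and> m \<le> n}. norm (\<Sum>i=m..n. f i v *\<^sub>R x i))"


section \<open>Banach spaces given as subspaces of an ambient space\<close>

text \<open>
  A normed space that depends on parameters is represented by a subspace \<open>S\<close> of a normed space;
  operators on it are functions whose values outside \<open>S\<close> are irrelevant.
\<close>

definition bounded_linear_on ::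
  "'z::real_normed_vector set \<Rightarrow> ('z \<Rightarrow> 'a::real_normed_vector) \<Rightarrow> bool" where
  "bounded_linear_on S T \<longleftrightarrow>
     (\<forall>u\<in>S. \<forall>v\<in>S. T (u + v) = T u + T v) \<and>
     (\<forall>r. \<forall>u\<in>S. T (r *\<^sub>R u) = r *\<^sub>R T u) \<and>
     (\<exists>B. \<forall>u\<in>S. norm (T u) \<le> B * norm u)"

text \<open>The analogue of \<^const>\<open>onorm\<close> for an operator defined on a subspace.\<close>

definition onorm_on ::
  "'z::real_normed_vector set \<Rightarrow> ('z \<Rightarrow> 'a::real_normed_vector) \<Rightarrow> real" where
  "onorm_on S T = (SUP u\<in>S. norm (T u) / norm u)"

definition schauder_basis_on :: "'z::real_normed_vector set \<Rightarrow> (nat \<Rightarrow> 'z) \<Rightarrow> bool" where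
  "schauder_basis_on Z z \<longleftrightarrow>
     (\<forall>n. z n \<in> Z) \<and> (\<forall>u\<in>Z. \<exists>!c::nat \<Rightarrow> real. (\<lambda>n. c n *\<^sub>R z n) sums u)"

text \<open>
  \<open>U\<close> is the bounded operator \<open>\<Sum>c\<^sub>n z\<^sub>n \<mapsto> \<Sum>c\<^sub>n y\<^sub>n\<close> on \<open>Z\<close>. If \<open>z\<close> is a basis of \<open>Z\<close>, this determines
  \<open>U\<close> on \<open>Z\<close>, and \<^const>\<open>sums\<close> includes the convergence of \<open>\<Sum>c\<^sub>n y\<^sub>n\<close>.
\<close>

definition synthesis_operator ::
  "'z::real_normed_vector set \<Rightarrow> (nat \<Rightarrow> 'z) \<Rightarrow> (nat \<Rightarrow> 'a::banach) \<Rightarrow> ('z \<Rightarrow> 'a) \<Rightarrow> bool" where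
  "synthesis_operator Z z y U \<longleftrightarrow>
     bounded_linear_on Z U \<and>
     (\<forall>(c::nat \<Rightarrow> real) u. u \<in> Z \<longrightarrow> (\<lambda>n. c n *\<^sub>R z n) sums u \<longrightarrow> (\<lambda>n. c n *\<^sub>R y n) sums U u)"

text \<open>\<open>V\<close> is the bounded operator \<open>v \<mapsto> \<Sum>g\<^sub>n(v) z\<^sub>n\<close> with values in \<open>Z\<close>.\<close>

definition analysis_operator ::
  "'z::real_normed_vector set \<Rightarrow> (nat \<Rightarrow> 'z) \<Rightarrow> (nat \<Rightarrow> 'a::banach \<Rightarrow>\<^sub>L real) \<Rightarrow> ('a \<Rightarrow> 'z) \<Rightarrow> bool" where
  "analysis_operator Z z g V \<longleftrightarrow>
     bounded_linear V \<and> range V \<subseteq> Z \<and> (\<forall>v. (\<lambda>n. g n v *\<^sub>R z n) sums V v)"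

definition associated_sequence_space ::
  "'z::real_normed_vector set \<Rightarrow> (nat \<Rightarrow> 'z) \<Rightarrow>
   (nat \<Rightarrow> 'a::banach) \<Rightarrow> (nat \<Rightarrow> 'a \<Rightarrow>\<^sub>L real) \<Rightarrow> bool" where
  "associated_sequence_space Z z y g \<longleftrightarrow>
     subspace Z \<and> complete Z \<and> schauder_basis_on Z z \<and> schauder_frame y g \<and>
     (\<exists>U. synthesis_operator Z z y U) \<and> (\<exists>V. analysis_operator Z z g V)"


section \<open>The minimal space\<close>

text \<open>
  The space of finitely supported scalar sequences is \<^typ>\<open>nat \<Rightarrow>\<^sub>0 real\<close>; only its vector space
  structure is used here, not the norm that the library puts on it.
\<close>

definition min_norm :: "(nat \<Rightarrow> 'a::real_normed_vector) \<Rightarrow> (nat \<Rightarrow>\<^sub>0 real) \<Rightarrow> real" where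
  "min_norm x c = Max {norm (\<Sum>i=m..n. Poly_Mapping.lookup c i *\<^sub>R x i) | m n. m \<le> n}"

text \<open>\<open>Z\<close> with the embedding \<open>J\<close> is a completion of the vector space \<open>'v\<close> normed by \<open>N\<close>.\<close>

definition completion_of ::
  "('v::real_vector \<Rightarrow> real) \<Rightarrow> 'z::real_normed_vector set \<Rightarrow> ('v \<Rightarrow> 'z) \<Rightarrow> bool" where
  "completion_of N Z J \<longleftrightarrow>
     subspace Z \<and> complete Z \<and> linear J \<and> (\<forall>v. norm (J v) = N v) \<and>
     range J \<subseteq> Z \<and> Z \<subseteq> closure (range J)"

text \<open>
  The completion is realised inside the Banach space of bounded functions from \<^typ>\<open>nat \<times> nat\<close>
  (which is discrete) to \<open>'a\<close> with the supremum norm: a finitely supported \<open>c\<close> is sent to the family of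
  its sums over the intervals \<open>{m..n}\<close>, and \<open>Z_Min\<close> is the closure of the image. That this is
  a completion for \<^const>\<open>min_norm\<close> is lemma \<open>completion_of_Z_Min\<close> below.
\<close>

definition min_embed ::
  "(nat \<Rightarrow> 'a::real_normed_vector) \<Rightarrow> (nat \<Rightarrow>\<^sub>0 real) \<Rightarrow> ((nat \<times> nat) \<Rightarrow>\<^sub>C 'a)" where
  "min_embed x c = Bcontfun (\<lambda>(m, n). \<Sum>i=m..n. Poly_Mapping.lookup c i *\<^sub>R x i)"

definition Z_Min :: "(nat \<Rightarrow> 'a::real_normed_vector) \<Rightarrow> ((nat \<times> nat) \<Rightarrow>\<^sub>C 'a) set" where
  "Z_Min x = closure (range (min_embed x))"

definition min_basis :: "(nat \<Rightarrow> 'a::real_normed_vector) \<Rightarrow> nat \<Rightarrow> ((nat \<times> nat) \<Rightarrow>\<^sub>C 'a)" where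
  "min_basis x n = min_embed x (Poly_Mapping.single n 1)"

lemma finite_interval_sums:
  fixes x :: "nat \<Rightarrow> 'a::real_normed_vector" and c :: "nat \<Rightarrow>\<^sub>0 real"
  shows "finite (range (\<lambda>(m, n). \<Sum>i=m..n. Poly_Mapping.lookup c i *\<^sub>R x i))"
proof (rule finite_subset)
  let ?s = "\<lambda>A. \<Sum>i\<in>A. Poly_Mapping.lookup c i *\<^sub>R x i"
  show "finite (?s ` Pow (Poly_Mapping.keys c))"
    by simp
  show "range (\<lambda>(m, n). ?s {m..n}) \<subseteq> ?s ` Pow (Poly_Mapping.keys c)"
  proof clarify
    fix m n
    have "?s {m..n} = ?s ({m..n} \<inter> Poly_Mapping.keys c)"
      by (rule sum.mono_neutral_right) (auto simp: in_keys_iff)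
    then show "?s {m..n} \<in> ?s ` Pow (Poly_Mapping.keys c)"
      by blast
  qed
qed

lemma apply_min_embed:
  "apply_bcontfun (min_embed x c) (m, n) = (\<Sum>i=m..n. Poly_Mapping.lookup c i *\<^sub>R x i)"
proof -
  have "open S" for S :: "(nat \<times> nat) set"
  proof (subst open_subopen, intro ballI)
    fix p assume "p \<in> S"
    then show "\<exists>T. open T \<and> p \<in> T \<and> T \<subseteq> S"
      using open_Times[OF open_discrete[of "{fst p}"] open_discrete[of "{snd p}"]]
      by (intro exI[of _ "{fst p} \<times> {snd p}"]) (simp add: mem_Times_iff)
  qed
  then have "(\<lambda>(m, n). \<Sum>i=m..n. Poly_Mapping.lookup c i *\<^sub>R x i) \<in> bcontfun"
    using finite_imp_bounded[OF finite_interval_sums[of c x]]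
    by (auto simp: bcontfun_def continuous_on_open_vimage)
  then show ?thesis
    by (simp add: min_embed_def Bcontfun_inverse)
qed

lemma linear_min_embed: "linear (min_embed x)"
proof (rule linearI)
  show "min_embed x (c + d) = min_embed x c + min_embed x d" for c d
    by (rule bcontfun_eqI)
      (clarsimp simp: apply_min_embed plus_bcontfun.rep_eq lookup_add scaleR_add_left sum.distrib)
  have "Poly_Mapping.lookup (r *\<^sub>R c) i = r * Poly_Mapping.lookup c i" for r i and c :: "nat \<Rightarrow>\<^sub>0 real"
    by (simp add: scaleR_poly_mapping_def lookup_Abs_poly_mapping
        finite_subset[OF _ finite_lookup[of c]] Collect_mono_iff)
  note lookup_scaleR = this
  show "min_embed x (r *\<^sub>R c) = r *\<^sub>R min_embed x c" for r c
    by (rule bcontfun_eqI)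
      (clarsimp simp: apply_min_embed lookup_scaleR scaleR_bcontfun.rep_eq scaleR_sum_right)
qed

lemma norm_min_embed: "norm (min_embed x c) = min_norm x c"
proof -
  let ?s = "\<lambda>m n. \<Sum>i=m..n. Poly_Mapping.lookup c i *\<^sub>R x i"
  let ?A = "{norm (?s m n) | m n. m \<le> n}"
  have "?A \<subseteq> norm ` range (\<lambda>(m, n). ?s m n)"
    by (auto simp: image_image intro!: image_eqI[where x = "(_, _)"])
  then have fin: "finite ?A"
    using finite_interval_sums[of c x] finite_surj by blast
  have upper: "norm (?s m n) \<le> Max ?A" if "m \<le> n" for m n
    using that by (intro Max_ge[OF fin]) auto
  show ?thesis
  proof (rule antisym)
    show "norm (min_embed x c) \<le> min_norm x c"
    proof (rule norm_bound)
      fix p :: "nat \<times> nat"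
      obtain m n where p: "p = (m, n)" by fastforce
      show "norm (apply_bcontfun (min_embed x c) p) \<le> min_norm x c"
      proof (cases "m \<le> n")
        case True
        then show ?thesis using upper by (simp add: p apply_min_embed min_norm_def)
      next
        case False
        have "0 \<le> norm (?s 0 0)" by simp
        also have "\<dots> \<le> Max ?A" by (rule upper) simp
        finally show ?thesis using False by (simp add: p apply_min_embed min_norm_def)
      qed
    qed
    have "Max ?A \<in> ?A"
      by (rule Max_in[OF fin]) auto
    then obtain m n where "Max ?A = norm (?s m n)" by auto
    then show "min_norm x c \<le> norm (min_embed x c)"
      using norm_bounded[of "min_embed x c" "(m, n)"] by (simp add: apply_min_embed min_norm_def)
  qed
qed

text \<open>
  The library's completeness result for \<^type>\<open>bcontfun\<close> assumes a metric on the domain, which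
  \<^typ>\<open>nat \<times> nat\<close> does not carry in the library.
\<close>

lemma complete_bcontfun:
  "complete (UNIV :: ('t::topological_space \<Rightarrow>\<^sub>C 'b::complete_space) set)"
proof (rule completeI)
  fix h :: "nat \<Rightarrow> 't \<Rightarrow>\<^sub>C 'b"
  assume "Cauchy h"
  have "uniformly_Cauchy_on UNIV (\<lambda>n. apply_bcontfun (h n))"
  proof (rule uniformly_Cauchy_onI)
    fix e :: real assume "e > 0"
    then obtain M where "\<forall>m\<ge>M. \<forall>n\<ge>M. dist (h m) (h n) < e"
      using metric_CauchyD[OF \<open>Cauchy h\<close>] by blast
    then show "\<exists>M. \<forall>t\<in>UNIV. \<forall>m\<ge>M. \<forall>n\<ge>M. dist (h m t) (h n t) < e"
      by (intro exI[of _ M] ballI allI impI dist_fun_lt_imp_dist_val_lt) simp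
  qed
  then have "uniformly_convergent_on UNIV (\<lambda>n. apply_bcontfun (h n))"
    by (rule Cauchy_uniformly_convergent)
  then obtain l where "uniform_limit UNIV (\<lambda>n. apply_bcontfun (h n)) l sequentially"
    unfolding uniformly_convergent_on_def by (rule exE)
  then obtain l' where "h \<longlonglongrightarrow> l'"
    by (rule uniform_limit_bcontfunE[OF _ sequentially_bot])
  then show "\<exists>l\<in>UNIV. h \<longlonglongrightarrow> l"
    by (intro bexI[of _ l'] UNIV_I)
qed

lemma completion_of_Z_Min:
  fixes x :: "nat \<Rightarrow> 'a::banach"
  shows "completion_of (min_norm x) (Z_Min x) (min_embed x)"
proof -
  have "subspace (Z_Min x)"
    unfolding Z_Min_def
  proof (rule subspaceI)
    let ?R = "range (min_embed x)"
    have R: "subspace ?R"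
      by (intro linear_subspace_image[OF linear_min_embed] subspace_UNIV)
    then show "0 \<in> closure ?R"
      using closure_subset subspace_0 by blast
    show "u + v \<in> closure ?R" if "u \<in> closure ?R" "v \<in> closure ?R" for u v
    proof -
      from that obtain a b where "\<forall>n. a n \<in> ?R" "a \<longlonglongrightarrow> u" "\<forall>n. b n \<in> ?R" "b \<longlonglongrightarrow> v"
        unfolding closure_sequential by blast
      then show ?thesis
        unfolding closure_sequential
        by (intro exI[of _ "\<lambda>n. a n + b n"] conjI allI subspace_add[OF R] tendsto_add) simp_all
    qed
    show "r *\<^sub>R u \<in> closure ?R" if "u \<in> closure ?R" for r u
    proof -
      from that obtain a where "\<forall>n. a n \<in> ?R" "a \<longlonglongrightarrow> u"
        unfolding closure_sequential by blast
      then show ?thesis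
        unfolding closure_sequential
        by (intro exI[of _ "\<lambda>n. r *\<^sub>R a n"] conjI allI subspace_scale[OF R] tendsto_scaleR tendsto_const) simp_all
    qed
  qed
  moreover have "complete (Z_Min x)"
    unfolding Z_Min_def using complete_closed_subset[OF closed_closure subset_UNIV complete_bcontfun] .
  ultimately show ?thesis
    by (simp add: completion_of_def linear_min_embed norm_min_embed Z_Min_def closure_subset)
qed

text \<open>If no \<open>x n\<close> vanishes, \<^const>\<open>min_norm\<close> is a norm and not only a seminorm.\<close>

lemma min_norm_eq_0_iff:
  assumes "\<And>n. x n \<noteq> 0"
  shows "min_norm x c = 0 \<longleftrightarrow> c = 0"
proof
  assume "min_norm x c = 0"
  then have 0: "min_embed x c = 0"
    using norm_min_embed[of x c] by simp
  show "c = 0"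
  proof (rule poly_mapping_eqI)
    fix i
    have "Poly_Mapping.lookup c i *\<^sub>R x i = 0"
      using apply_min_embed[of x c i i] by (simp add: 0)
    with assms show "Poly_Mapping.lookup c i = Poly_Mapping.lookup 0 i"
      by simp
  qed
next
  assume "c = 0"
  then show "min_norm x c = 0"
    using norm_min_embed[of x c] linear_0[OF linear_min_embed[of x]] by simp
qed

end

theory Submission
  imports Defs
begin

text \<open>
  The frame operator \<open>T v = \<Sum>f\<^sub>n(v) y\<^sub>n\<close> satisfies \<open>\<parallel>v - T v\<parallel> \<le> \<mu> \<parallel>v\<parallel>\<close>, so it has an inverse \<open>S\<close> of norm at most
  \<open>1 / (1 - \<mu>)\<close>, and \<open>g\<^sub>n = f\<^sub>n \<circ> S\<close> works. The series \<open>\<Sum>g\<^sub>n(v) e\<^sub>n\<close> converges in \<open>Z_Min\<close> because its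
  interval sums have the norms of interval sums of \<open>\<Sum>f\<^sub>n(S v) x\<^sub>n\<close>; this gives the upper bound for \<open>V\<close>.
  For \<open>u = \<Sum>c\<^sub>n e\<^sub>n\<close> one has \<open>\<bar>c\<^sub>n\<bar> \<parallel>x\<^sub>n\<parallel> \<le> \<parallel>u\<parallel>\<close>, so \<open>\<Sum>c\<^sub>n (x\<^sub>n - y\<^sub>n)\<close> is absolutely convergent with
  norm at most \<open>\<lambda> \<parallel>u\<parallel>\<close>, which bounds \<open>U\<close>; the lower bound for \<open>V\<close> follows from \<open>U (V v) = v\<close>.
\<close>

section \<open>Uniform boundedness and the projection constant\<close>

text \<open>Baire category: the closed sets \<open>C k\<close> cover the Banach space, so one of
  them contains a ball \<open>ball a e\<close>. Writing a small \<open>w\<close> as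
  \<open>(a + w) - a\<close> bounds every \<open>A i w\<close> by \<open>2 * real k\<close>, and
  scaling does the rest.\<close>

lemma uniform_boundedness_principle:
  fixes A :: "'i \<Rightarrow> 'a::banach \<Rightarrow> 'b::real_normed_vector"
  assumes A: "\<And>i. bounded_linear (A i)"
    and bounded: "\<And>v. \<exists>B. \<forall>i. norm (A i v) \<le> B"
  shows "\<exists>B. \<forall>i v. norm (A i v) \<le> B * norm v"
proof -
  define C where "C k = {v. \<forall>i. norm (A i v) \<le> real k}" for k :: nat
  have C_closed: "closed (C k)" for k
    unfolding C_def
    by (intro closed_Collect_all closed_Collect_le continuous_intros
        bounded_linear.continuous_on[OF A])
  have "v \<in> (\<Union>k. C k)" for v
  proof -
    obtain B where B: "\<And>i. norm (A i v) \<le> B"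
      using bounded by blast
    obtain k :: nat where "B \<le> real k"
      using real_arch_simple by blast
    then have "v \<in> C k"
      unfolding C_def using B order_trans by blast
    then show ?thesis by blast
  qed
  then have C_UN: "(\<Union>k. C k) = UNIV" by blast
  have "\<exists>k. interior (C k) \<noteq> {}"
  proof (rule ccontr)
    assume "\<nexists>k. interior (C k) \<noteq> {}"
    then have "(euclidean :: 'a topology) interior_of \<Union>(range C) = {}"
      using C_closed
      by (intro Baire_category_alt disjI1 completely_metrizable_space_euclidean) auto
    then show False
      by (simp add: C_UN)
  qed
  then obtain k a where "a \<in> interior (C k)" by blast
  then obtain e where "e > 0" and e: "ball a e \<subseteq> C k"
    unfolding mem_interior by blast
  have small: "norm (A i w) \<le> 2 * real k" if "norm w < e" for i w
  proof -
    have "a + w \<in> C k" "a \<in> C k"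
      using that \<open>e > 0\<close> e by (auto simp: dist_norm subset_iff)
    then have "norm (A i (a + w)) \<le> real k" "norm (A i a) \<le> real k"
      by (auto simp: C_def)
    moreover have "A i w = A i (a + w) - A i a"
      by (simp add: linear_simps(1)[OF A])
    ultimately show ?thesis
      using norm_triangle_ineq4[of "A i (a + w)" "A i a"] by simp
  qed
  have "norm (A i v) \<le> (4 * real k / e) * norm v" for i v
  proof (cases "v = 0")
    case True
    then show ?thesis by (simp add: linear_simps(3)[OF A])
  next
    case False
    \<comment> \<open>\<open>t\<close> scales \<open>v\<close> to norm \<open>e / 2\<close>,
      strictly inside the ball; dividing \<open>2 * real k\<close> by it produces the constant
      \<open>4 * real k / e\<close>.\<close>
    define t where "t = e / (2 * norm v)"
    have "t > 0" using False \<open>e > 0\<close> by (simp add: t_def)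
    have "norm (t *\<^sub>R v) < e"
      using False \<open>e > 0\<close> by (simp add: t_def)
    then have "t * norm (A i v) \<le> 2 * real k"
      using small[of "t *\<^sub>R v" i] \<open>t > 0\<close> by (simp add: linear_simps(5)[OF A])
    then have "norm (A i v) \<le> 2 * real k / t"
      using \<open>t > 0\<close> by (simp add: field_simps)
    also have "\<dots> = (4 * real k / e) * norm v"
      using False by (simp add: t_def)
    finally show ?thesis .
  qed
  then show ?thesis by blast
qed

lemma summable_imp_interval_sums_bounded:
  fixes u :: "nat \<Rightarrow> 'a::real_normed_vector"
  assumes "summable u"
  shows "\<exists>B. \<forall>m n. norm (\<Sum>i=m..n. u i) \<le> B"
proof -
  have "Bseq (\<lambda>n. \<Sum>i<n. u i)"
    using assms by (simp add: convergent_imp_Bseq summable_iff_convergent)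
  then obtain B where "B > 0" and B: "\<And>n. norm (\<Sum>i<n. u i) \<le> B"
    by (auto elim: BseqE)
  have "norm (\<Sum>i=m..n. u i) \<le> 2 * B" for m n
  proof (cases "m \<le> n")
    case True
    then have "{m..n} = {..<Suc n} - {..<m}" by auto
    then have "(\<Sum>i=m..n. u i) = (\<Sum>i<Suc n. u i) - (\<Sum>i<m. u i)"
      using True by (metis finite_lessThan lessThan_subset_iff le_SucI sum_diff)
    then show ?thesis
      using norm_triangle_ineq4[of "\<Sum>i<Suc n. u i" "\<Sum>i<m. u i"] B[of "Suc n"] B[of m] by simp
  qed (use \<open>B > 0\<close> in simp)
  then show ?thesis by blast
qed

text \<open>A real \<open>SUP\<close> dominates its members only when the set is bounded above. Here
  this comes from uniform boundedness of the interval sum operators, which are pointwise bounded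
  because each frame expansion converges.\<close>

lemma norm_interval_sum_le_projection_constant:
  fixes x :: "nat \<Rightarrow> 'a::banach"
  assumes "schauder_frame x f"
  shows "norm (\<Sum>i=m..n. f i v *\<^sub>R x i) \<le> projection_constant x f * norm v"
proof -
  define P where "P = (\<lambda>(m, n) v. \<Sum>i=m..n. f i v *\<^sub>R x i)"
  define I :: "('a \<times> nat \<times> nat) set" where "I = {(v, m, n). norm v \<le> 1 \<and> m \<le> n}"
  have P_linear: "bounded_linear (P p)" for p
    unfolding P_def
    by (cases p) (auto intro!: bounded_linear_sum
        bounded_linear_compose[OF bounded_linear_scaleR_left blinfun.bounded_linear_right])
  have "\<exists>B. \<forall>p v. norm (P p v) \<le> B * norm v"
  proof (rule uniform_boundedness_principle[OF P_linear])
    fix v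
    have "summable (\<lambda>i. f i v *\<^sub>R x i)"
      using assms by (auto simp: schauder_frame_def sums_iff)
    then show "\<exists>B. \<forall>p. norm (P p v) \<le> B"
      using summable_imp_interval_sums_bounded by (force simp: P_def)
  qed
  then obtain B where B: "\<And>p v. norm (P p v) \<le> B * norm v" by blast
  have bdd: "bdd_above ((\<lambda>(v, m, n). norm (\<Sum>i=m..n. f i v *\<^sub>R x i)) ` I)"
  proof (rule bdd_aboveI2)
    fix q assume q: "q \<in> I"
    obtain v m n where [simp]: "q = (v, m, n)" by (cases q)
    have "norm (P (m, n) v) \<le> B * norm v" by (rule B)
    also have "\<dots> \<le> \<bar>B\<bar> * 1"
      using q by (intro mult_mono) (auto simp: I_def)
    finally show "(case q of (v, m, n) \<Rightarrow> norm (\<Sum>i=m..n. f i v *\<^sub>R x i)) \<le> \<bar>B\<bar>"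
      by (simp add: P_def)
  qed
  have unit: "norm (P (m, n) v) \<le> projection_constant x f" if "norm v \<le> 1" "m \<le> n" for m n v
    unfolding projection_constant_def I_def[symmetric]
    using cSUP_upper[OF _ bdd, of "(v, m, n)"] that by (simp add: I_def P_def)
  \<comment> \<open>The sign settles the cases \<open>v = 0\<close> and \<open>m > n\<close>, where
    the sum vanishes.\<close>
  have K: "projection_constant x f \<ge> 0"
    using order_trans[OF norm_ge_zero unit[of 0 0 0]] by simp
  have "norm (P (m, n) v) \<le> projection_constant x f * norm v"
  proof (cases "m \<le> n \<and> v \<noteq> 0")
    case True
    then have "norm (P (m, n) (v /\<^sub>R norm v)) \<le> projection_constant x f"
      by (intro unit) auto
    then show ?thesis
      using True by (simp add: linear_simps(5)[OF P_linear] field_simps)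
  next
    case False
    then show ?thesis
      using K by (auto simp: P_def)
  qed
  then show ?thesis by (simp add: P_def)
qed

section \<open>Inverting the perturbed frame operator\<close>

text \<open>The map \<open>w \<mapsto> v + R w\<close> contracts with factor \<open>\<mu>\<close>,
  so Banach's fixed point theorem solves \<open>w - R w = v\<close> uniquely. Uniqueness makes the
  solution operator linear; its norm bound comes from absorbing \<open>\<mu> * norm (S v)\<close> on
  the left.\<close>

lemma inverse_of_perturbed_identity:
  fixes R :: "'a::banach \<Rightarrow> 'a"
  assumes R: "linear R" and bound: "\<And>v. norm (R v) \<le> \<mu> * norm v"
    and \<mu>: "0 \<le> \<mu>" "\<mu> < 1"
  shows "\<exists>S :: 'a \<Rightarrow>\<^sub>L 'a. \<forall>v. S v - R (S v) = v \<and> norm (S v) \<le> norm v / (1 - \<mu>)"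
proof -
  have "\<exists>!w. v + R w = w" for v
    using bound \<mu> by (intro banach_fix_type[of \<mu>]) (auto simp: dist_norm simp flip: linear_diff[OF R])
  then have ex1: "\<exists>!w. w - R w = v" for v
    by (metis (no_types, lifting) add_diff_cancel_right' diff_add_cancel)
  define S where "S v = (THE w. w - R w = v)" for v
  have S: "S v - R (S v) = v" for v
    unfolding S_def by (rule theI'[OF ex1])
  have S_unique: "S v = w" if "w - R w = v" for v w
    using ex1[of v] S that by blast
  have S_bound: "norm (S v) \<le> norm v / (1 - \<mu>)" for v
  proof -
    have "norm (S v) \<le> norm v + norm (R (S v))"
      using norm_triangle_ineq[of v "R (S v)"] S[of v] by (metis diff_eq_eq)
    then show ?thesis
      using bound[of "S v"] \<mu> by (simp add: field_simps)
  qed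
  have "bounded_linear S"
  proof (rule bounded_linear_intro)
    show "S (u + v) = S u + S v" for u v
      using S[of u] S[of v] by (intro S_unique) (simp add: linear_add[OF R] add_diff_add)
    show "S (r *\<^sub>R v) = r *\<^sub>R S v" for r v
      using S[of v] by (intro S_unique) (simp add: linear_scale[OF R] flip: scaleR_diff_right)
    show "norm (S v) \<le> norm v * (1 / (1 - \<mu>))" for v
      using S_bound[of v] by simp
  qed
  then have "blinfun_apply (Blinfun S) = S"
    by (rule bounded_linear_Blinfun_apply)
  with S S_bound show ?thesis by (metis (no_types, lifting))
qed

text \<open>With \<open>R v\<close> the sum of \<open>f n v *\<^sub>R (x n - y n)\<close>, the
  perturbed expansion of \<open>v\<close> has sum \<open>v - R v\<close>, and
  \<open>norm (R v) \<le> \<mu> * norm v\<close>. The absolute convergence is recorded because it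
  carries unconditional convergence from \<open>x\<close> to \<open>y\<close>.\<close>

lemma perturbed_frame_operator:
  fixes x y :: "nat \<Rightarrow> 'a::banach"
  assumes frame: "schauder_frame x f"
    and \<mu>: "(\<lambda>n. norm (x n - y n) * norm (f n)) sums \<mu>" "\<mu> < 1"
  shows "\<exists>S :: 'a \<Rightarrow>\<^sub>L 'a. \<forall>v. (\<lambda>n. f n (S v) *\<^sub>R y n) sums v \<and>
    summable (\<lambda>n. norm (f n (S v) *\<^sub>R (x n - y n))) \<and> norm (S v) \<le> norm v / (1 - \<mu>)"
proof -
  define R where "R v = suminf (\<lambda>n. f n v *\<^sub>R (x n - y n))" for v
  have term_le: "norm (f n v *\<^sub>R (x n - y n)) \<le> norm (x n - y n) * norm (f n) * norm v" for n v
    using mult_left_mono[OF norm_blinfun[of "f n" v] norm_ge_zero[of "x n - y n"]]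
    by (simp add: mult_ac)
  have majorant: "(\<lambda>n. norm (x n - y n) * norm (f n) * norm v) sums (\<mu> * norm v)" for v
    by (rule sums_mult2[OF \<mu>(1)])
  have abs_summable: "summable (\<lambda>n. norm (f n v *\<^sub>R (x n - y n)))" for v
    by (rule summable_comparison_test'[OF sums_summable[OF majorant[of v]]])
      (use term_le in simp)
  have R_sums: "(\<lambda>n. f n v *\<^sub>R (x n - y n)) sums R v" for v
    unfolding R_def by (rule summable_sums[OF summable_norm_cancel[OF abs_summable]])
  have "linear R"
  proof (rule linearI)
    show "R (u + v) = R u + R v" for u v
      using sums_add[OF R_sums R_sums, of u v] R_sums[of "u + v"]
      by (simp add: blinfun.add_right sums_unique2 flip: scaleR_add_left)
    show "R (r *\<^sub>R v) = r *\<^sub>R R v" for r v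
      using sums_scaleR_right[OF R_sums, of r v] R_sums[of "r *\<^sub>R v"]
      by (simp add: blinfun.scaleR_right sums_unique2)
  qed
  moreover have "norm (R v) \<le> \<mu> * norm v" for v
    using norm_suminf_le[OF term_le sums_summable[OF majorant], of v] sums_unique[OF majorant, of v]
    by (simp add: R_def)
  moreover have "0 \<le> \<mu>"
    by (rule sums_le[OF _ sums_zero \<mu>(1)]) simp
  ultimately obtain S :: "'a \<Rightarrow>\<^sub>L 'a"
    where S: "\<And>v. S v - R (S v) = v" "\<And>v. norm (S v) \<le> norm v / (1 - \<mu>)"
    using inverse_of_perturbed_identity[OF _ _ _ \<mu>(2)] by blast
  have S_frame: "(\<lambda>n. f n (S v) *\<^sub>R x n) sums S v" for v
    using frame by (simp add: schauder_frame_def)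
  \<comment> \<open>Subtracting the series for \<open>R (S v)\<close> from the frame expansion of
    \<open>S v\<close> leaves \<open>S v - R (S v) = v\<close>.\<close>
  have "(\<lambda>n. f n (S v) *\<^sub>R y n) sums v" for v
    using sums_diff[OF S_frame[of v] R_sums[of "S v"]] by (simp add: S scaleR_diff_right)
  with S abs_summable show ?thesis by blast
qed

text \<open>An absolutely convergent difference survives every rearrangement, and \<open>w\<close>
  is \<open>u\<close> minus that difference.\<close>

lemma unconditionally_convergent_perturbation:
  fixes u w :: "nat \<Rightarrow> 'a::banach"
  assumes u: "unconditionally_convergent u" and diff: "summable (\<lambda>n. norm (u n - w n))"
  shows "unconditionally_convergent w"
  unfolding unconditionally_convergent_def
proof (intro allI impI)
  fix p :: "nat \<Rightarrow> nat" assume p: "bij p"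
  have "summable ((\<lambda>n. norm (u n - w n)) \<circ> p)"
    by (rule summable_reindex[OF diff bij_is_inj[OF p]]) simp
  then have "summable (\<lambda>n. u (p n) - w (p n))"
    by (auto simp: o_def intro: summable_norm_cancel)
  moreover have "summable (\<lambda>n. u (p n))"
    using u p by (simp add: unconditionally_convergent_def)
  ultimately show "summable (\<lambda>n. w (p n))"
    using summable_diff[of "\<lambda>n. u (p n)" "\<lambda>n. u (p n) - w (p n)"] by simp
qed

section \<open>Coordinates in \<open>Z_Min\<close> and the minimal basis\<close>

lemma bounded_linear_apply_bcontfun:
  "bounded_linear (\<lambda>u :: 't::topological_space \<Rightarrow>\<^sub>C 'b::real_normed_vector. apply_bcontfun u p)"
  by (rule bounded_linear_intro[where K = 1]) (auto intro: norm_bounded)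

lemma apply_min_basis:
  "apply_bcontfun (min_basis x k) (m, n) = (if k \<in> {m..n} then x k else 0)"
proof -
  have "apply_bcontfun (min_basis x k) (m, n) = (\<Sum>i=m..n. if i = k then x k else 0)"
    unfolding min_basis_def apply_min_embed
    by (intro sum.cong) (auto simp: lookup_single)
  then show ?thesis by simp
qed

lemma apply_sum_min_basis:
  assumes "finite A"
  shows "apply_bcontfun (\<Sum>k\<in>A. a k *\<^sub>R min_basis x k) (m, n) = (\<Sum>i\<in>A \<inter> {m..n}. a i *\<^sub>R x i)"
proof -
  have "apply_bcontfun (\<Sum>k\<in>A. a k *\<^sub>R min_basis x k) (m, n) =
      (\<Sum>k\<in>A. apply_bcontfun (a k *\<^sub>R min_basis x k) (m, n))"
    by (rule linear_sum[OF bounded_linear.linear[OF bounded_linear_apply_bcontfun]])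
  also have "\<dots> = (\<Sum>k\<in>A. if k \<in> {m..n} then a k *\<^sub>R x k else 0)"
    by (intro sum.cong) (auto simp: apply_min_basis)
  finally show ?thesis
    by (simp only: sum.inter_restrict[OF assms])
qed

lemma subspace_Z_Min: "subspace (Z_Min (x :: nat \<Rightarrow> 'a::banach))"
  using completion_of_Z_Min[of x] by (simp add: completion_of_def)

lemma min_basis_in_Z_Min: "min_basis x n \<in> Z_Min x"
  unfolding min_basis_def Z_Min_def by (intro subsetD[OF closure_subset] rangeI)

text \<open>For \<open>a \<noteq> 0\<close> the map multiplies norms by \<open>norm a\<close>, so
  the image of the complete real line is complete. This lets the property of being a multiple of
  \<open>x i\<close> pass to limits in \<open>Z_Min\<close>.\<close>

lemma closed_range_scaleR_left:
  fixes a :: "'a::real_normed_vector"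
  shows "closed (range (\<lambda>r::real. r *\<^sub>R a))"
proof (cases "a = 0")
  case False
  then show ?thesis
    by (intro complete_imp_closed complete_isometric_image[of "norm a"] bounded_linear_scaleR_left)
      (auto simp: complete_UNIV mult.commute)
qed simp

text \<open>
  Evaluating \<open>u\<close> at \<open>(i, i)\<close> yields the \<open>i\<close>-th term of its expansion. That this term is a multiple of
  \<open>x i\<close>, and that \<open>u\<close> is additive over intervals, are closed conditions that hold on the image of
  \<^const>\<open>min_embed\<close>.
\<close>

lemma Z_Min_coefficients:
  fixes x :: "nat \<Rightarrow> 'a::real_normed_vector"
  assumes "u \<in> Z_Min x"
  shows "\<exists>c. \<forall>m n. apply_bcontfun u (m, n) = (\<Sum>i=m..n. c i *\<^sub>R x i)"
proof -
  let ?S = "{w. (\<forall>m n. apply_bcontfun w (m, n) = (\<Sum>i=m..n. apply_bcontfun w (i, i))) \<and>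
    (\<forall>i. apply_bcontfun w (i, i) \<in> range (\<lambda>r::real. r *\<^sub>R x i))}"
  note eval = bounded_linear.continuous_on[OF bounded_linear_apply_bcontfun]
  have "closed {w. apply_bcontfun w (i, i) \<in> range (\<lambda>r::real. r *\<^sub>R x i)}" for i
    using closed_vimage[OF closed_range_scaleR_left eval[OF continuous_on_id]]
    by (simp add: vimage_def)
  then have "closed ?S"
    by (intro closed_Collect_conj closed_Collect_all closed_Collect_eq eval continuous_intros)
  moreover have "range (min_embed x) \<subseteq> ?S"
    by (auto simp: apply_min_embed)
  ultimately have "closure (range (min_embed x)) \<subseteq> ?S"
    by (intro closure_minimal)
  with assms have "u \<in> ?S"
    unfolding Z_Min_def by (rule rev_subsetD)
  then have sum: "\<And>m n. apply_bcontfun u (m, n) = (\<Sum>i=m..n. apply_bcontfun u (i, i))"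
    and "\<forall>i. \<exists>r. apply_bcontfun u (i, i) = r *\<^sub>R x i"
    by blast+
  then obtain c where c: "\<And>i. apply_bcontfun u (i, i) = c i *\<^sub>R x i"
    by metis
  have "apply_bcontfun u (m, n) = (\<Sum>i=m..n. c i *\<^sub>R x i)" for m n
    by (subst sum) (simp only: c)
  then show ?thesis by blast
qed

text \<open>A finitely supported approximant has zero interval sums beyond its support, so there
  \<open>u\<close> is no larger than the approximation error, uniformly in \<open>n\<close>.\<close>

lemma Z_Min_tail:
  assumes "u \<in> Z_Min x" "e > 0"
  shows "\<exists>N. \<forall>m\<ge>N. \<forall>n. norm (apply_bcontfun u (m, n)) < e"
proof -
  obtain c where c: "dist (min_embed x c) u < e"
    using assms unfolding Z_Min_def closure_approachable by blast
  obtain N where N: "Poly_Mapping.keys c \<subseteq> {..<N}"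
    using finite_nat_iff_bounded finite_keys by blast
  have "norm (apply_bcontfun u (m, n)) < e" if "m \<ge> N" for m n
  proof -
    have "apply_bcontfun (min_embed x c) (m, n) = 0"
      unfolding apply_min_embed using N that
      by (intro sum.neutral) (force simp: in_keys_iff subset_iff)
    then show ?thesis
      using norm_bounded[of "min_embed x c - u" "(m, n)"] c by (simp add: dist_norm)
  qed
  then show ?thesis by blast
qed

text \<open>Evaluation is continuous, and at \<open>(m, n)\<close> only the finitely many basis
  vectors with index in \<open>{m..n}\<close> contribute.\<close>

lemma sums_min_basis_apply:
  assumes "(\<lambda>n. c n *\<^sub>R min_basis x n) sums u"
  shows "apply_bcontfun u (m, n) = (\<Sum>i=m..n. c i *\<^sub>R x i)"
proof -
  have "(\<lambda>k. apply_bcontfun (c k *\<^sub>R min_basis x k) (m, n)) sums apply_bcontfun u (m, n)"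
    by (rule bounded_linear.sums[OF bounded_linear_apply_bcontfun assms])
  moreover have "(\<lambda>k. apply_bcontfun (c k *\<^sub>R min_basis x k) (m, n)) sums
      (\<Sum>k=m..n. apply_bcontfun (c k *\<^sub>R min_basis x k) (m, n))"
    by (rule sums_finite) (auto simp: apply_min_basis)
  ultimately show ?thesis
    by (simp add: sums_unique2 apply_min_basis)
qed

text \<open>The remainder after \<open>M\<close> terms takes at \<open>(m, n)\<close> the value of
  \<open>u\<close> at \<open>(max m M, n)\<close>, up to sign, and this is uniformly small by
  \<open>Z_Min_tail\<close>.\<close>

lemma sums_min_basis:
  assumes u: "u \<in> Z_Min x"
    and c: "\<And>m n. apply_bcontfun u (m, n) = (\<Sum>i=m..n. c i *\<^sub>R x i)"
  shows "(\<lambda>n. c n *\<^sub>R min_basis x n) sums u"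
  unfolding sums_def
proof (rule LIMSEQ_I)
  fix r :: real assume "r > 0"
  then obtain N where N: "\<And>m n. m \<ge> N \<Longrightarrow> norm (apply_bcontfun u (m, n)) < r / 2"
    using Z_Min_tail[OF u, of "r / 2"] by auto
  \<comment> \<open>Half of \<open>r\<close> is used because a pointwise bound gives only a
    non-strict bound on the supremum norm.\<close>
  have "norm ((\<Sum>i<M. c i *\<^sub>R min_basis x i) - u) \<le> r / 2" if "M \<ge> N" for M
  proof (rule norm_bound)
    fix p :: "nat \<times> nat"
    obtain m n where p: "p = (m, n)" by fastforce
    have "(\<Sum>i=m..n. c i *\<^sub>R x i) =
        (\<Sum>i\<in>{..<M} \<inter> {m..n}. c i *\<^sub>R x i) + (\<Sum>i=max m M..n. c i *\<^sub>R x i)"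
      by (subst sum.union_disjoint[symmetric]) (auto intro!: sum.cong)
    then have "apply_bcontfun ((\<Sum>i<M. c i *\<^sub>R min_basis x i) - u) p = - apply_bcontfun u (max m M, n)"
      by (simp add: p apply_sum_min_basis c)
    then show "norm (apply_bcontfun ((\<Sum>i<M. c i *\<^sub>R min_basis x i) - u) p) \<le> r / 2"
      using less_imp_le[OF N[of "max m M" n]] that by simp
  qed
  then show "\<exists>N. \<forall>M\<ge>N. norm ((\<Sum>i<M. c i *\<^sub>R min_basis x i) - u) < r"
    using \<open>r > 0\<close> by (intro exI[of _ N]) (fastforce intro: le_less_trans)
qed

text \<open>The values of a difference of partial sums are, up to sign, interval sums of the series
  in \<open>x\<close>, so the Cauchy criterion transfers from there to the supremum norm.\<close>

lemma min_basis_series_converges: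
  fixes x :: "nat \<Rightarrow> 'a::banach"
  assumes "summable (\<lambda>n. c n *\<^sub>R x n)"
  shows "\<exists>u\<in>Z_Min x. (\<lambda>n. c n *\<^sub>R min_basis x n) sums u"
proof -
  let ?s = "\<lambda>N. \<Sum>n<N. c n *\<^sub>R min_basis x n"
  have s_in: "?s N \<in> Z_Min x" for N
    by (intro subspace_sum subspace_scale subspace_Z_Min min_basis_in_Z_Min)
  have "Cauchy ?s"
  proof (rule CauchyI')
    fix e :: real assume "e > 0"
    then obtain N where N: "\<And>m n. m \<ge> N \<Longrightarrow> norm (\<Sum>i=m..<n. c i *\<^sub>R x i) < e / 2"
      using assms unfolding summable_Cauchy by (meson half_gt_zero)
    have "dist (?s k) (?s l) \<le> e / 2" if "N \<le> k" "k < l" for k l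
      unfolding dist_norm
    proof (rule norm_bound)
      fix p :: "nat \<times> nat"
      obtain m n where p: "p = (m, n)" by fastforce
      \<comment> \<open>The part from \<open>k\<close> on is written half-open, with end
        \<open>min l (Suc n)\<close>, to match the form of \<open>summable_Cauchy\<close>.\<close>
      have "(\<Sum>i\<in>{..<l} \<inter> {m..n}. c i *\<^sub>R x i) =
          (\<Sum>i\<in>{..<k} \<inter> {m..n}. c i *\<^sub>R x i) + (\<Sum>i=max m k..<min l (Suc n). c i *\<^sub>R x i)"
        using \<open>k < l\<close> by (subst sum.union_disjoint[symmetric]) (auto intro!: sum.cong)
      then have "apply_bcontfun (?s k - ?s l) p = - (\<Sum>i=max m k..<min l (Suc n). c i *\<^sub>R x i)"
        by (simp add: p apply_sum_min_basis)
      then show "norm (apply_bcontfun (?s k - ?s l) p) \<le> e / 2"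
        using less_imp_le[OF N[of "max m k" "min l (Suc n)"]] \<open>N \<le> k\<close> by simp
    qed
    then show "\<exists>N. \<forall>k\<ge>N. \<forall>l>k. dist (?s k) (?s l) < e"
      using \<open>e > 0\<close> by (intro exI[of _ N]) (fastforce intro: le_less_trans)
  qed
  moreover have "complete (Z_Min x)"
    using completion_of_Z_Min[of x] by (simp add: completion_of_def)
  ultimately obtain u where "u \<in> Z_Min x" "?s \<longlonglongrightarrow> u"
    using completeE[of "Z_Min x" ?s] s_in by auto
  then show ?thesis
    unfolding sums_def by blast
qed

lemma schauder_basis_on_Z_Min:
  fixes x :: "nat \<Rightarrow> 'a::banach"
  assumes "\<And>n. x n \<noteq> 0"
  shows "schauder_basis_on (Z_Min x) (min_basis x)"
  unfolding schauder_basis_on_def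
proof (intro conjI allI ballI ex_ex1I)
  fix u assume u: "u \<in> Z_Min x"
  then obtain c where "\<And>m n. apply_bcontfun u (m, n) = (\<Sum>i=m..n. c i *\<^sub>R x i)"
    using Z_Min_coefficients by metis
  from sums_min_basis[OF u this]
  show "\<exists>c::nat \<Rightarrow> real. (\<lambda>n. c n *\<^sub>R min_basis x n) sums u"
    by blast
next
  fix u
  fix c d :: "nat \<Rightarrow> real"
  assume c: "(\<lambda>n. c n *\<^sub>R min_basis x n) sums u" and d: "(\<lambda>n. d n *\<^sub>R min_basis x n) sums u"
  show "c = d"
  proof
    fix n
    \<comment> \<open>Evaluation at \<open>(n, n)\<close> isolates one term, giving
      \<open>c n *\<^sub>R x n = d n *\<^sub>R x n\<close> with
      \<open>x n \<noteq> 0\<close>.\<close>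
    show "c n = d n"
      using sums_min_basis_apply[OF c, of n n] sums_min_basis_apply[OF d, of n n] assms[of n] by simp
  qed
qed (rule min_basis_in_Z_Min)

section \<open>Synthesis and analysis operators on \<open>Z_Min\<close>\<close>

text \<open>The operator is split as \<open>L - D\<close>: \<open>L\<close> expands along
  \<open>x\<close> and \<open>D\<close> along \<open>x n - y n\<close>. The partial sums of
  \<open>L u\<close> are the values of \<open>u\<close> at \<open>(0, n)\<close>, so
  \<open>L\<close> contributes the 1 in the bound and \<open>D\<close> contributes
  \<open>lam\<close>.\<close>

lemma synthesis_operator_Z_Min:
  fixes x y :: "nat \<Rightarrow> 'a::banach"
  assumes x: "\<And>n. x n \<noteq> 0"
    and lam: "(\<lambda>n. norm (x n - y n) / norm (x n)) sums lam"
  shows "\<exists>U. synthesis_operator (Z_Min x) (min_basis x) y U \<and>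
    (\<forall>u\<in>Z_Min x. norm (U u) \<le> (1 + lam) * norm u)"
proof -
  have basis: "\<exists>!c. (\<lambda>n. c n *\<^sub>R min_basis x n) sums u" if "u \<in> Z_Min x" for u
    using schauder_basis_on_Z_Min[of x, OF x] that unfolding schauder_basis_on_def by blast
  define c where "c u = (THE c. (\<lambda>n. c n *\<^sub>R min_basis x n) sums u)" for u
  have c_sums: "(\<lambda>n. c u n *\<^sub>R min_basis x n) sums u" if "u \<in> Z_Min x" for u
    unfolding c_def by (rule theI'[OF basis[OF that]])
  have c_unique: "c u = d" if "u \<in> Z_Min x" "(\<lambda>n. d n *\<^sub>R min_basis x n) sums u" for u d
    unfolding c_def by (rule the1_equality[OF basis]) (fact that)+
  note c_apply = sums_min_basis_apply[OF c_sums]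
  define L where "L u = suminf (\<lambda>n. c u n *\<^sub>R x n)" for u
  define D where "D u = suminf (\<lambda>n. c u n *\<^sub>R (x n - y n))" for u
  define U where "U u = L u - D u" for u
  have L_sums: "(\<lambda>n. c u n *\<^sub>R x n) sums L u" if u: "u \<in> Z_Min x" for u
    unfolding L_def
  proof (rule summable_sums, unfold summable_Cauchy, intro allI impI)
    fix e :: real assume "e > 0"
    \<comment> \<open>Tail smallness of \<open>u\<close> is exactly the Cauchy criterion for this
      series.\<close>
    then obtain N where N: "\<And>m n. m \<ge> N \<Longrightarrow> norm (\<Sum>i=m..n. c u i *\<^sub>R x i) < e"
      using Z_Min_tail[OF u, of e] by (auto simp: c_apply[OF u])
    have "norm (\<Sum>i=m..<n. c u i *\<^sub>R x i) < e" if "m \<ge> N" for m n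
      using N[OF that] \<open>e > 0\<close> by (cases n) (auto simp: atLeastLessThanSuc_atLeastAtMost)
    then show "\<exists>N. \<forall>m\<ge>N. \<forall>n. norm (\<Sum>i=m..<n. c u i *\<^sub>R x i) < e" by blast
  qed
  have L_bound: "norm (L u) \<le> norm u" if u: "u \<in> Z_Min x" for u
  proof (rule LIMSEQ_le_const2)
    show "(\<lambda>n. norm (\<Sum>i\<le>n. c u i *\<^sub>R x i)) \<longlonglongrightarrow> norm (L u)"
      using L_sums[OF u] unfolding sums_def_le by (rule tendsto_norm)
    show "\<exists>N. \<forall>n\<ge>N. norm (\<Sum>i\<le>n. c u i *\<^sub>R x i) \<le> norm u"
      using norm_bounded[of u "(0, _)"] by (simp add: c_apply[OF u] atMost_atLeast0)
  qed
  have majorant: "(\<lambda>n. norm u * (norm (x n - y n) / norm (x n))) sums (norm u * lam)" for u :: "(nat \<times> nat) \<Rightarrow>\<^sub>C 'a"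
    by (rule sums_mult[OF lam])
  have D_term: "norm (c u n *\<^sub>R (x n - y n)) \<le> norm u * (norm (x n - y n) / norm (x n))"
    if u: "u \<in> Z_Min x" for u n
  proof -
    have "\<bar>c u n\<bar> * norm (x n) \<le> norm u"
      using norm_bounded[of u "(n, n)"] by (simp add: c_apply[OF u])
    then have "\<bar>c u n\<bar> * norm (x n) * (norm (x n - y n) / norm (x n))
        \<le> norm u * (norm (x n - y n) / norm (x n))"
      by (intro mult_right_mono) auto
    then show ?thesis using x[of n] by simp
  qed
  have D_sums: "(\<lambda>n. c u n *\<^sub>R (x n - y n)) sums D u" if u: "u \<in> Z_Min x" for u
    unfolding D_def
    by (rule summable_sums[OF summable_comparison_test'[OF sums_summable[OF majorant]]], rule D_term[OF u])
  have D_bound: "norm (D u) \<le> norm u * lam" if u: "u \<in> Z_Min x" for u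
    using norm_suminf_le[OF D_term[OF u] sums_summable[OF majorant]] sums_unique[OF majorant[of u]]
    by (simp add: D_def)
  have U_sums: "(\<lambda>n. c u n *\<^sub>R y n) sums U u" if u: "u \<in> Z_Min x" for u
    using sums_diff[OF L_sums[OF u] D_sums[OF u]] by (simp add: U_def scaleR_diff_right)
  have U_bound: "norm (U u) \<le> (1 + lam) * norm u" if u: "u \<in> Z_Min x" for u
    using norm_triangle_ineq4[of "L u" "D u"] L_bound[OF u] D_bound[OF u]
    by (simp add: U_def algebra_simps)
  \<comment> \<open>Uniqueness of coefficients makes \<open>c\<close> additive on
    \<open>Z_Min\<close>, and additivity of \<open>U\<close> follows termwise.\<close>
  have "U (u + v) = U u + U v" if u: "u \<in> Z_Min x" and v: "v \<in> Z_Min x" for u v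
  proof -
    have uv: "u + v \<in> Z_Min x"
      by (rule subspace_add[OF subspace_Z_Min u v])
    have "c (u + v) = (\<lambda>n. c u n + c v n)"
      using sums_add[OF c_sums[OF u] c_sums[OF v]] by (intro c_unique[OF uv]) (simp add: scaleR_add_left)
    then show ?thesis
      using U_sums[OF uv] sums_add[OF U_sums[OF u] U_sums[OF v]]
      by (simp add: sums_unique2 scaleR_add_left)
  qed
  moreover have "U (r *\<^sub>R u) = r *\<^sub>R U u" if u: "u \<in> Z_Min x" for r u
  proof -
    have ru: "r *\<^sub>R u \<in> Z_Min x"
      by (rule subspace_scale[OF subspace_Z_Min u])
    have "c (r *\<^sub>R u) = (\<lambda>n. r * c u n)"
      using sums_scaleR_right[OF c_sums[OF u], of r] by (intro c_unique[OF ru]) simp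
    then show ?thesis
      using U_sums[OF ru] sums_scaleR_right[OF U_sums[OF u], of r]
      by (simp add: sums_unique2)
  qed
  ultimately have "synthesis_operator (Z_Min x) (min_basis x) y U"
    unfolding synthesis_operator_def bounded_linear_on_def
  proof (intro conjI allI ballI impI exI[of _ "1 + lam"])
    show "(\<lambda>n. d n *\<^sub>R y n) sums U u"
      if "u \<in> Z_Min x" "(\<lambda>n. d n *\<^sub>R min_basis x n) sums u" for d :: "nat \<Rightarrow> real" and u
      using U_sums[OF that(1)] c_unique[OF that] by simp
  qed (use U_bound in auto)
  with U_bound show ?thesis by blast
qed

text \<open>At \<open>u = 0\<close> the quotient is 0 by the convention for division by zero, which
  is where \<open>0 \<le> B\<close> enters.\<close>

lemma onorm_on_le:
  assumes "S \<noteq> {}" "0 \<le> B" "\<And>u. u \<in> S \<Longrightarrow> norm (T u) \<le> B * norm u"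
  shows "onorm_on S T \<le> B"
  unfolding onorm_on_def
proof (rule cSUP_least)
  fix u assume "u \<in> S"
  then show "norm (T u) / norm u \<le> B"
    using assms by (cases "u = 0") (auto simp: field_simps)
qed (rule assms)

text \<open>The values of \<open>V v\<close> are the interval sums of
  \<open>g n v *\<^sub>R x n\<close>, so the assumed uniform bound on them is a bound on the
  supremum norm.\<close>

lemma analysis_operator_Z_Min:
  fixes x :: "nat \<Rightarrow> 'a::banach" and g :: "nat \<Rightarrow> 'a \<Rightarrow>\<^sub>L real"
  assumes conv: "\<And>v. summable (\<lambda>n. g n v *\<^sub>R x n)"
    and bound: "\<And>v m n. norm (\<Sum>i=m..n. g i v *\<^sub>R x i) \<le> B * norm v"
  shows "\<exists>V. analysis_operator (Z_Min x) (min_basis x) g V \<and> (\<forall>v. norm (V v) \<le> B * norm v)"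
proof -
  obtain V where V: "\<And>v. V v \<in> Z_Min x" and V_sums: "\<And>v. (\<lambda>n. g n v *\<^sub>R min_basis x n) sums V v"
    using min_basis_series_converges[OF conv] by metis
  note V_apply = sums_min_basis_apply[OF V_sums]
  have V_bound: "norm (V v) \<le> B * norm v" for v
  proof (rule norm_bound)
    fix p show "norm (apply_bcontfun (V v) p) \<le> B * norm v"
      using bound by (cases p) (simp add: V_apply)
  qed
  have "bounded_linear V"
  proof (rule bounded_linear_intro)
    show "V (u + v) = V u + V v" for u v
      using sums_add[OF V_sums V_sums, of u v] V_sums[of "u + v"]
      by (simp add: blinfun.add_right sums_unique2 flip: scaleR_add_left)
    show "V (r *\<^sub>R v) = r *\<^sub>R V v" for r v
      using sums_scaleR_right[OF V_sums, of r v] V_sums[of "r *\<^sub>R v"]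
      by (simp add: blinfun.scaleR_right sums_unique2)
    show "norm (V v) \<le> norm v * B" for v
      using V_bound[of v] by (simp add: mult.commute)
  qed
  with V V_sums V_bound show ?thesis
    unfolding analysis_operator_def by blast
qed

section \<open>The perturbed frame and its two operators\<close>

theorem theorem3p1:
  fixes x y :: "nat \<Rightarrow> 'a::banach" and f :: "nat \<Rightarrow> 'a \<Rightarrow>\<^sub>L real" and \<mu> :: real
  assumes "schauder_frame x f"
    and "(\<lambda>n. norm (x n - y n) * norm (f n)) sums \<mu>"
    and "\<mu> < 1"
  shows "\<exists>g :: nat \<Rightarrow> 'a \<Rightarrow>\<^sub>L real.
    schauder_frame y g \<and>
    (unconditional_schauder_frame x f \<longrightarrow> unconditional_schauder_frame y g) \<and>
    (\<forall>lam :: real.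
      (\<forall>n. x n \<noteq> 0) \<longrightarrow> (\<lambda>n. norm (x n - y n) / norm (x n)) sums lam \<longrightarrow>
      associated_sequence_space (Z_Min x) (min_basis x) y g \<and>
      (\<exists>U. synthesis_operator (Z_Min x) (min_basis x) y U \<and>
           onorm_on (Z_Min x) U \<le> 1 + lam) \<and>
      (\<exists>V. analysis_operator (Z_Min x) (min_basis x) g V \<and>
           (\<forall>v. 1 / (1 + lam) * norm v \<le> norm (V v) \<and>
                norm (V v) \<le> projection_constant x f / (1 - \<mu>) * norm v)))"
proof -
  let ?K = "projection_constant x f"
  obtain S :: "'a \<Rightarrow>\<^sub>L 'a" where S_sums: "\<And>v. (\<lambda>n. f n (S v) *\<^sub>R y n) sums v"
    and S_diff: "\<And>v. summable (\<lambda>n. norm (f n (S v) *\<^sub>R (x n - y n)))"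
    and S_bound: "\<And>v. norm (S v) \<le> norm v / (1 - \<mu>)"
    using perturbed_frame_operator[OF assms] by blast
  define g where "g n = f n o\<^sub>L S" for n
  have g [simp]: "g n v = f n (S v)" for n v
    by (simp add: g_def)
  have frame: "schauder_frame y g"
    using S_sums by (simp add: schauder_frame_def)
  moreover have "unconditional_schauder_frame y g" if "unconditional_schauder_frame x f"
    unfolding unconditional_schauder_frame_def
  proof (intro conjI allI frame)
    fix v
    \<comment> \<open>Unconditionality of the original frame is applied at the vector
      \<open>S v\<close>.\<close>
    have "unconditionally_convergent (\<lambda>n. f n (S v) *\<^sub>R x n)"
      using that by (simp add: unconditional_schauder_frame_def)
    then show "unconditionally_convergent (\<lambda>n. g n v *\<^sub>R y n)"
      by (rule unconditionally_convergent_perturbation)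
        (use S_diff[of v] in \<open>simp add: scaleR_diff_right\<close>)
  qed
  moreover have "associated_sequence_space (Z_Min x) (min_basis x) y g \<and>
      (\<exists>U. synthesis_operator (Z_Min x) (min_basis x) y U \<and>
           onorm_on (Z_Min x) U \<le> 1 + lam) \<and>
      (\<exists>V. analysis_operator (Z_Min x) (min_basis x) g V \<and>
           (\<forall>v. 1 / (1 + lam) * norm v \<le> norm (V v) \<and>
                norm (V v) \<le> ?K / (1 - \<mu>) * norm v))"
    if x: "\<forall>n. x n \<noteq> 0" and lam: "(\<lambda>n. norm (x n - y n) / norm (x n)) sums lam" for lam
  proof -
    have lam_nonneg: "0 \<le> lam"
      by (rule sums_le[OF _ sums_zero lam]) simp
    obtain U where U: "synthesis_operator (Z_Min x) (min_basis x) y U"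
      and U_bound: "\<And>u. u \<in> Z_Min x \<Longrightarrow> norm (U u) \<le> (1 + lam) * norm u"
      using synthesis_operator_Z_Min[OF _ lam] x by blast
    have "norm (\<Sum>i=m..n. g i v *\<^sub>R x i) \<le> ?K / (1 - \<mu>) * norm v" for v and m n :: nat
    proof -
      have K: "norm (\<Sum>i=k..l. f i w *\<^sub>R x i) \<le> ?K * norm w" for w and k l :: nat
        by (rule norm_interval_sum_le_projection_constant[OF assms(1)])
      show ?thesis
      proof (cases "v = 0")
        case False
        \<comment> \<open>The sign of \<open>?K\<close> is needed to multiply the bound on
          \<open>S v\<close> by it; for \<open>v = 0\<close> both sides vanish.\<close>
        then have "0 \<le> ?K"
          using order_trans[OF norm_ge_zero K[where w = v]] by (simp add: zero_le_mult_iff)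
        then have "?K * norm (S v) \<le> ?K * (norm v / (1 - \<mu>))"
          by (intro mult_left_mono S_bound)
        then show ?thesis
          using K[of "S v" m n] by simp
      qed (simp add: blinfun.zero_right)
    qed
    \<comment> \<open>This is the original frame expansion of \<open>S v\<close>, so its sum is
      \<open>S v\<close> rather than \<open>v\<close>.\<close>
    moreover have "summable (\<lambda>n. g n v *\<^sub>R x n)" for v
      using assms(1) by (auto simp: schauder_frame_def sums_iff)
    ultimately obtain V where V: "analysis_operator (Z_Min x) (min_basis x) g V"
      and V_bound: "\<And>v. norm (V v) \<le> ?K / (1 - \<mu>) * norm v"
      using analysis_operator_Z_Min[of g x] by blast
    have "norm v \<le> (1 + lam) * norm (V v)" for v
    proof -
      have V_in: "V v \<in> Z_Min x" and "(\<lambda>n. g n v *\<^sub>R min_basis x n) sums V v"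
        using V by (auto simp: analysis_operator_def)
      then have "(\<lambda>n. g n v *\<^sub>R y n) sums U (V v)"
        using U by (simp add: synthesis_operator_def)
      then have "U (V v) = v"
        using S_sums[of v] by (simp add: sums_unique2)
      then show ?thesis
        using U_bound[OF V_in] by simp
    qed
    then have V_lower: "1 / (1 + lam) * norm v \<le> norm (V v)" for v
      using lam_nonneg by (simp add: field_simps)
    have "onorm_on (Z_Min x) U \<le> 1 + lam"
      using min_basis_in_Z_Min lam_nonneg by (intro onorm_on_le U_bound) auto
    moreover have "associated_sequence_space (Z_Min x) (min_basis x) y g"
      unfolding associated_sequence_space_def
      using completion_of_Z_Min[of x] schauder_basis_on_Z_Min[of x] x frame U V
      by (auto simp: completion_of_def)
    ultimately show ?thesis
      using U V V_lower V_bound by blast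
  qed
  ultimately show ?thesis by blast
qed

end
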